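(* Let $\epsilon\in\{1,-1\}$, let $g_0$ be a constant, real, symmetric, invertible $2\times2$ matrix, and let $\phi$ be a smooth real function on an open set $U\subset\mathbb{R}^2$ with $\rho=1+\epsilon g_0^{\mu\nu}\phi_{,\mu}\phi_{,\nu}>0$ on $U$. Let $h_{\mu\nu}=g_{0\,\mu\nu}+\epsilon\phi_{,\mu}\phi_{,\nu}$, let $g_{\mu\nu}=\rho^{-1/2}h_{\mu\nu}$, and let $g$ be the $2\times2$ matrix $(g_{\mu\nu})$. If the graph of $\phi$ is minimal, i.e. $H=\rho^{-1/2}h^{\mu\nu}\phi_{,\mu\nu}=0$, then $$\partial_\alpha\big[g^{\alpha\beta}\,g^{-1}\,\partial_\beta g\big]=0$$ as an equation for $2\times 2$ matrix-valued functions on $U$.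
   Context: Greek indices take the values $1,2$; repeated indices are summed; a comma denotes partial differentiation ($\phi_{,\mu}=\partial_\mu\phi$, $\phi_{,\mu\nu}=\partial_\mu\partial_\nu\phi$). $g_0^{\mu\nu}$, $h^{\mu\nu}$, $g^{\mu\nu}$ are the components of the inverse matrices of $g_0,h,g$. In the conclusion $g^{\alpha\beta}$ are scalar coefficients, while $g^{-1}\partial_\beta g$ is a product of $2\times2$ matrices. The surface in question is the graph $x^3=\phi(x^1,x^2)$ in the flat space with metric $g_{0\,\mu\nu}dx^\mu dx^\nu+\epsilon(dx^3)^2$. *)

theory Defs
  imports "HOL-Analysis.Analysis"
begin

text \<open>All derivatives below are used only at points of an open set. Functions are total, so values
  off that set are irrelevant.\<close>

definition partial :: "'n::finite \<Rightarrow> (real^'n \<Rightarrow> 'b::real_normed_vector) \<Rightarrow> real^'n \<Rightarrow> 'b" where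
  "partial i f x = vector_derivative (\<lambda>t. f (x + t *\<^sub>R axis i 1)) (at 0)"

text \<open>For open \<open>S\<close>, membership in the classes \<open>C\<^sup>k\<close> and \<open>C\<^sup>\<infinity>\<close>: the Frechet derivative exists
  throughout \<open>S\<close>, and each directional derivative lies in the class one order lower.\<close>

fun times_cont_diff_on ::
  "nat \<Rightarrow> ('a::real_normed_vector \<Rightarrow> 'b::real_normed_vector) \<Rightarrow> 'a set \<Rightarrow> bool" where
  "times_cont_diff_on 0 f S \<longleftrightarrow> continuous_on S f"
| "times_cont_diff_on (Suc k) f S \<longleftrightarrow>
     (\<forall>x\<in>S. f differentiable (at x)) \<and>
     (\<forall>v. times_cont_diff_on k (\<lambda>x. frechet_derivative f (at x) v) S)"

definition smooth_on :: "('a::real_normed_vector \<Rightarrow> 'b::real_normed_vector) \<Rightarrow> 'a set \<Rightarrow> bool" where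
  "smooth_on f S \<longleftrightarrow> (\<forall>k. times_cont_diff_on k f S)"

text \<open>In the following, \<open>g0\<close> and \<open>e\<close> are the data of the flat ambient metric
  \<open>g0\<^sub>\<mu>\<^sub>\<nu> dx\<^sup>\<mu> dx\<^sup>\<nu> + e (dx\<^sup>3)\<^sup>2\<close>, and the surface is the graph \<open>x\<^sup>3 = \<phi>(x\<^sup>1, x\<^sup>2)\<close>. Its induced
  metric is \<open>induced_metric\<close>, with \<open>det h = \<rho> det g0\<close>; hence \<open>h\<close> and the rescaled metric \<open>g\<close> are
  invertible wherever \<open>\<rho> > 0\<close> and \<open>g0\<close> is invertible.\<close>

definition graph_rho :: "real \<Rightarrow> real^2^2 \<Rightarrow> (real^2 \<Rightarrow> real) \<Rightarrow> real^2 \<Rightarrow> real" where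
  "graph_rho e g0 \<phi> x =
     1 + e * (\<Sum>\<mu>\<in>UNIV. \<Sum>\<nu>\<in>UNIV. matrix_inv g0 $ \<mu> $ \<nu> * partial \<mu> \<phi> x * partial \<nu> \<phi> x)"

definition induced_metric :: "real \<Rightarrow> real^2^2 \<Rightarrow> (real^2 \<Rightarrow> real) \<Rightarrow> real^2 \<Rightarrow> real^2^2" where
  "induced_metric e g0 \<phi> x = (\<chi> \<mu> \<nu>. g0 $ \<mu> $ \<nu> + e * partial \<mu> \<phi> x * partial \<nu> \<phi> x)"

definition rescaled_metric :: "real \<Rightarrow> real^2^2 \<Rightarrow> (real^2 \<Rightarrow> real) \<Rightarrow> real^2 \<Rightarrow> real^2^2" where
  "rescaled_metric e g0 \<phi> x = (graph_rho e g0 \<phi> x powr (-1/2)) *\<^sub>R induced_metric e g0 \<phi> x"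

definition graph_mean_curvature :: "real \<Rightarrow> real^2^2 \<Rightarrow> (real^2 \<Rightarrow> real) \<Rightarrow> real^2 \<Rightarrow> real" where
  "graph_mean_curvature e g0 \<phi> x =
     graph_rho e g0 \<phi> x powr (-1/2) *
     (\<Sum>\<mu>\<in>UNIV. \<Sum>\<nu>\<in>UNIV.
        matrix_inv (induced_metric e g0 \<phi> x) $ \<mu> $ \<nu> * partial \<mu> (partial \<nu> \<phi>) x)"

end

theory Submission
  imports Defs
begin

text \<open>Since \<open>det g = det g0\<close> is constant, \<open>g\<^sup>\<alpha>\<^sup>\<beta>\<close> is the cofactor matrix of \<open>g\<close> divided by a
  constant. Up to a nonzero factor, \<open>g\<^sub>\<mu>\<^sub>1\<^sub>,\<^sub>2 - g\<^sub>\<mu>\<^sub>2\<^sub>,\<^sub>1\<close> is a component of the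
  gradient \<open>g0\<^sup>\<alpha>\<^sup>\<beta> \<phi>\<^sub>,\<^sub>\<beta>\<close> times \<open>h\<^sup>\<mu>\<^sup>\<nu> \<phi>\<^sub>,\<^sub>\<mu>\<^sub>\<nu>\<close>, so for a minimal graph \<open>g\<^sub>\<mu>\<^sub>\<nu>\<^sub>,\<^sub>\<lambda>\<close> is totally symmetric: \<open>g\<close> is locally a Hessian
  with constant determinant, a solution of a Monge-Ampere equation. For such a \<open>g\<close> the divergence
  vanishes: \<open>\<partial>\<^sub>\<alpha> g\<^sup>\<alpha>\<^sup>\<beta> = 0\<close> by symmetry, and differentiating \<open>g\<^sup>\<alpha>\<^sup>\<beta> g\<^sub>\<alpha>\<^sub>\<beta>\<^sub>,\<^sub>\<lambda> = 0\<close> once more gives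
  \<open>g\<^sup>\<alpha>\<^sup>\<beta> \<partial>\<^sub>\<alpha>\<partial>\<^sub>\<beta> g = g\<^sup>\<alpha>\<^sup>\<beta> (\<partial>\<^sub>\<alpha> g) g\<^sup>-\<^sup>1 (\<partial>\<^sub>\<beta> g)\<close>.\<close>

section \<open>Calculus of the classes of \<open>k\<close> times continuously differentiable
  functions\<close>

text \<open>On an open set a derivative depends only on the values in that set. This allows
  derivatives that are known by a formula only on \<open>S\<close> to be replaced by that
  formula.\<close>

lemma times_cont_diff_on_cong:
  assumes "open S" and "\<And>x. x \<in> S \<Longrightarrow> f x = g x"
  shows "times_cont_diff_on k f S \<longleftrightarrow> times_cont_diff_on k g S"
  using assms(2)
proof (induction k arbitrary: f g)
  case 0
  then show ?case by (auto cong: continuous_on_cong)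
next
  case (Suc k)
  have *: "f differentiable (at x) \<longleftrightarrow> g differentiable (at x)" if "x \<in> S" for x
    using that Suc.prems \<open>open S\<close>
    by (metis differentiable_def has_derivative_transform_within_open)
  have "frechet_derivative f (at x) = frechet_derivative g (at x)"
    if "x \<in> S" "f differentiable (at x)" for x
    using that Suc.prems \<open>open S\<close> by (metis frechet_derivative_transform_within_open)
  then show ?case
    using * Suc.IH[of "\<lambda>x. frechet_derivative f (at x) v" "\<lambda>x. frechet_derivative g (at x) v" for v]
    by auto
qed

text \<open>By uniqueness of the derivative, any explicit formula \<open>f'\<close> may stand in for
  \<open>frechet_derivative\<close>. The closure properties below are inductions through this
  rule.\<close>

lemma times_cont_diff_on_SucI:
  assumes "open S" and "\<And>x. x \<in> S \<Longrightarrow> (f has_derivative f' x) (at x)"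
    and "\<And>v. times_cont_diff_on k (\<lambda>x. f' x v) S"
  shows "times_cont_diff_on (Suc k) f S"
proof -
  have "f' x = frechet_derivative f (at x)" if "x \<in> S" for x
    using assms(2)[OF that] by (rule frechet_derivative_at)
  then have "times_cont_diff_on k (\<lambda>x. frechet_derivative f (at x) v) S" for v
    using assms(3)[of v]
      times_cont_diff_on_cong[OF \<open>open S\<close>, of "\<lambda>x. f' x v" "\<lambda>x. frechet_derivative f (at x) v"]
    by simp
  then show ?thesis using assms(2) by (auto simp: differentiable_def)
qed

text \<open>Product and power rules leave undifferentiated factors, for which the induction needs
  membership at the lower order \<open>k\<close>.\<close>

lemma times_cont_diff_on_SucD:
  "times_cont_diff_on (Suc k) f S \<Longrightarrow> times_cont_diff_on k f S"
proof (induction k arbitrary: f)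
  case 0
  then show ?case
    by (simp add: continuous_at_imp_continuous_on differentiable_imp_continuous_within)
next
  case (Suc k)
  then show ?case by (metis times_cont_diff_on.simps(2))
qed

lemma times_cont_diff_on_has_derivative:
  "times_cont_diff_on (Suc k) f S \<Longrightarrow> x \<in> S \<Longrightarrow> (f has_derivative frechet_derivative f (at x)) (at x)"
  by (simp add: frechet_derivative_works)

lemma times_cont_diff_on_frechet:
  "times_cont_diff_on (Suc k) f S \<Longrightarrow> times_cont_diff_on k (\<lambda>x. frechet_derivative f (at x) v) S"
  by simp

lemma times_cont_diff_on_const: "times_cont_diff_on k (\<lambda>x. c) S"
  by (induction k arbitrary: c) simp_all

lemma times_cont_diff_on_add:
  assumes "open S" "times_cont_diff_on k f S" "times_cont_diff_on k g S"
  shows "times_cont_diff_on k (\<lambda>x. f x + g x) S"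
  using assms(2,3)
proof (induction k arbitrary: f g)
  case 0
  then show ?case by (simp add: continuous_on_add)
next
  case (Suc k)
  show ?case
  proof (rule times_cont_diff_on_SucI[OF \<open>open S\<close>])
    show "((\<lambda>x. f x + g x) has_derivative
        (\<lambda>h. frechet_derivative f (at x) h + frechet_derivative g (at x) h)) (at x)" if "x \<in> S" for x
      using Suc.prems that by (intro has_derivative_add times_cont_diff_on_has_derivative[of k])
    show "times_cont_diff_on k (\<lambda>x. frechet_derivative f (at x) v + frechet_derivative g (at x) v) S" for v
      using Suc.prems by (intro Suc.IH times_cont_diff_on_frechet)
  qed
qed

lemma times_cont_diff_on_mult:
  fixes f g :: "'a::real_normed_vector \<Rightarrow> real"
  assumes "open S" "times_cont_diff_on k f S" "times_cont_diff_on k g S"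
  shows "times_cont_diff_on k (\<lambda>x. f x * g x) S"
  using assms(2,3)
proof (induction k arbitrary: f g)
  case 0
  then show ?case by (simp add: continuous_on_mult)
next
  case (Suc k)
  note low = Suc.prems[THEN times_cont_diff_on_SucD]
  show ?case
  proof (rule times_cont_diff_on_SucI[OF \<open>open S\<close>])
    show "((\<lambda>x. f x * g x) has_derivative
        (\<lambda>h. f x * frechet_derivative g (at x) h + frechet_derivative f (at x) h * g x)) (at x)"
      if "x \<in> S" for x
      using Suc.prems that by (intro has_derivative_mult times_cont_diff_on_has_derivative[of k])
    show "times_cont_diff_on k
        (\<lambda>x. f x * frechet_derivative g (at x) v + frechet_derivative f (at x) v * g x) S" for v
      using Suc.prems low
      by (intro times_cont_diff_on_add[OF \<open>open S\<close>] Suc.IH times_cont_diff_on_frechet)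
  qed
qed

text \<open>The induction is over all exponents at once, because differentiation turns
  \<open>r\<close> into \<open>r - 1\<close>.\<close>

lemma times_cont_diff_on_powr:
  fixes f :: "'a::real_normed_vector \<Rightarrow> real"
  assumes "open S" "times_cont_diff_on k f S" "\<And>x. x \<in> S \<Longrightarrow> f x > 0"
  shows "times_cont_diff_on k (\<lambda>x. f x powr r) S"
  using assms(2)
proof (induction k arbitrary: r)
  case 0
  have "\<forall>x\<in>S. f x \<noteq> 0" using assms(3) by force
  with 0 show ?case by (auto intro!: continuous_on_powr continuous_on_const)
next
  case (Suc k)
  show ?case
  proof (rule times_cont_diff_on_SucI[OF \<open>open S\<close>])
    fix x assume "x \<in> S"
    \<comment> \<open>The library rule allows a varying exponent; the summand
      \<open>0 * ln (f x)\<close> is the contribution of the constant one.\<close>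
    have "((\<lambda>x. f x powr r) has_derivative (\<lambda>h. (f x powr r) *
       (0 * ln (f x) + frechet_derivative f (at x) h * r / f x))) (at x)"
      using assms(3) \<open>x \<in> S\<close> Suc.prems
      by (intro has_derivative_powr times_cont_diff_on_has_derivative[of k]) auto
    then show "((\<lambda>x. f x powr r) has_derivative
        (\<lambda>h. (f x powr (r - 1) * r) * frechet_derivative f (at x) h)) (at x)"
      using assms(3)[OF \<open>x \<in> S\<close>] by (simp add: powr_diff mult_ac)
  next
    fix v
    show "times_cont_diff_on k (\<lambda>x. (f x powr (r - 1) * r) * frechet_derivative f (at x) v) S"
      using Suc.prems times_cont_diff_on_SucD[OF Suc.prems]
      by (intro times_cont_diff_on_mult[OF \<open>open S\<close>] times_cont_diff_on_const
          times_cont_diff_on_frechet Suc.IH)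
  qed
qed

section \<open>Symmetry of second derivatives\<close>

lemma has_real_derivative_along:
  fixes f :: "'a::real_normed_vector \<Rightarrow> real"
  assumes "f differentiable at (p + s *\<^sub>R u)"
  shows "((\<lambda>t. f (p + t *\<^sub>R u)) has_real_derivative frechet_derivative f (at (p + s *\<^sub>R u)) u) (at s)"
proof -
  let ?D = "frechet_derivative f (at (p + s *\<^sub>R u))"
  have "(f has_derivative ?D) (at (p + s *\<^sub>R u))"
    using assms by (simp add: frechet_derivative_works)
  moreover have "((\<lambda>t. p + t *\<^sub>R u) has_derivative (\<lambda>t. t *\<^sub>R u)) (at s)"
    by (auto intro!: derivative_eq_intros)
  ultimately have "((\<lambda>t. f (p + t *\<^sub>R u)) has_derivative (\<lambda>t. ?D (t *\<^sub>R u))) (at s)"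
    using diff_chain_at by (fastforce simp: o_def)
  moreover have "?D (t *\<^sub>R u) = t * ?D u" for t
    using linear_frechet_derivative[OF assms] by (simp add: linear_cmul)
  ultimately show ?thesis
    by (simp add: has_field_derivative_def mult_commute_abs)
qed

text \<open>The mean value theorem is applied twice: first in \<open>s\<close> to the increment of
  \<open>f\<close> by \<open>h *\<^sub>R v\<close>, then in \<open>t\<close> to the derivative of
  \<open>f\<close> in direction \<open>u\<close>.\<close>

lemma second_difference_mvt:
  fixes f :: "'a::real_normed_vector \<Rightarrow> real"
  assumes f: "times_cont_diff_on 2 f S" and "h > 0"
    and S: "\<And>s t. 0 \<le> s \<Longrightarrow> s \<le> h \<Longrightarrow> 0 \<le> t \<Longrightarrow> t \<le> h \<Longrightarrow> x + s *\<^sub>R u + t *\<^sub>R v \<in> S"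
  obtains s t where "0 < s" "s < h" "0 < t" "t < h"
    and "f (x + h *\<^sub>R u + h *\<^sub>R v) - f (x + h *\<^sub>R u) - f (x + h *\<^sub>R v) + f x =
      h * h * frechet_derivative (\<lambda>y. frechet_derivative f (at y) u) (at (x + s *\<^sub>R u + t *\<^sub>R v)) v"
proof -
  let ?D = "\<lambda>y. frechet_derivative f (at y) u"
  have df: "f differentiable at y" and dD: "?D differentiable at y" if "y \<in> S" for y
    using f that by (auto simp: numeral_2_eq_2)
  have d1: "((\<lambda>s. f (x + s *\<^sub>R u + h *\<^sub>R v) - f (x + s *\<^sub>R u)) has_real_derivative
      ?D (x + s *\<^sub>R u + h *\<^sub>R v) - ?D (x + s *\<^sub>R u)) (at s)" if "0 \<le> s" "s \<le> h" for s
    using has_real_derivative_along[of f "x + h *\<^sub>R v" s u] has_real_derivative_along[of f x s u]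
      df[OF S[OF that, of h]] df[OF S[OF that, of 0]] \<open>h > 0\<close>
    by (auto intro!: DERIV_diff simp: algebra_simps)
  obtain s where s: "0 < s" "s < h" and
    "(f (x + h *\<^sub>R u + h *\<^sub>R v) - f (x + h *\<^sub>R u)) - (f (x + 0 *\<^sub>R u + h *\<^sub>R v) - f (x + 0 *\<^sub>R u)) =
      (h - 0) * (?D (x + s *\<^sub>R u + h *\<^sub>R v) - ?D (x + s *\<^sub>R u))"
    using MVT2[OF \<open>h > 0\<close> d1] by blast
  moreover have d2: "((\<lambda>t. ?D (x + s *\<^sub>R u + t *\<^sub>R v)) has_real_derivative
      frechet_derivative ?D (at (x + s *\<^sub>R u + t *\<^sub>R v)) v) (at t)" if "0 \<le> t" "t \<le> h" for t
    using s that by (intro has_real_derivative_along dD S) auto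
  obtain t where t: "0 < t" "t < h" and
    "?D (x + s *\<^sub>R u + h *\<^sub>R v) - ?D (x + s *\<^sub>R u + 0 *\<^sub>R v) =
      (h - 0) * frechet_derivative ?D (at (x + s *\<^sub>R u + t *\<^sub>R v)) v"
    using MVT2[OF \<open>h > 0\<close> d2] by blast
  ultimately show thesis
    using that[OF s t] by simp
qed

text \<open>The second difference over a parallelogram is unchanged when \<open>u\<close> and
  \<open>v\<close> are exchanged. Hence the two mixed derivatives agree at a pair of points near
  \<open>x\<close>, and continuity carries the equality to \<open>x\<close>.\<close>

lemma frechet_derivative_second_symmetric:
  fixes f :: "'a::real_normed_vector \<Rightarrow> real"
  assumes "open S" and f: "times_cont_diff_on 2 f S" and "x \<in> S"
  shows "frechet_derivative (\<lambda>y. frechet_derivative f (at y) u) (at x) v =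
    frechet_derivative (\<lambda>y. frechet_derivative f (at y) v) (at x) u"
proof -
  define D where "D u v y = frechet_derivative (\<lambda>z. frechet_derivative f (at z) u) (at y) v" for u v y
  have "isCont (D u v) x" "isCont (D v u) x"
    using f \<open>x \<in> S\<close> \<open>open S\<close>
    by (auto simp: numeral_2_eq_2 continuous_on_eq_continuous_at D_def[abs_def])
  have "\<bar>D u v x - D v u x\<bar> \<le> e" if "e > 0" for e
  proof -
    have "\<forall>\<^sub>F y in nhds x. y \<in> S \<and> dist (D u v y) (D u v x) < e/2 \<and> dist (D v u y) (D v u x) < e/2"
      using \<open>isCont (D u v) x\<close> \<open>isCont (D v u) x\<close> \<open>e > 0\<close> \<open>x \<in> S\<close> \<open>open S\<close>
      by (intro eventually_conj eventually_nhds_in_open tendstoD) (auto simp: isCont_def tendsto_at_iff_tendsto_nhds)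
    then obtain d where "d > 0" and d: "\<And>y. dist y x < d \<Longrightarrow> y \<in> S \<and>
        dist (D u v y) (D u v x) < e/2 \<and> dist (D v u y) (D v u x) < e/2"
      unfolding eventually_nhds_metric by blast
    \<comment> \<open>With this size the whole parallelogram lies in the ball of radius
      \<open>d\<close>. The summand 1 keeps the denominator positive when \<open>u\<close> and
      \<open>v\<close> vanish.\<close>
    define h where "h = d / (norm u + norm v + 1)"
    have pos: "norm u + norm v + 1 > 0" by (simp add: add_nonneg_pos)
    have "h > 0" using \<open>d > 0\<close> pos by (simp add: h_def)
    have near: "dist (x + s *\<^sub>R u + t *\<^sub>R v) x < d" if "0 \<le> s" "s \<le> h" "0 \<le> t" "t \<le> h" for s t
    proof -
      have "dist (x + s *\<^sub>R u + t *\<^sub>R v) x \<le> s * norm u + t * norm v"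
        using that norm_triangle_ineq[of "s *\<^sub>R u" "t *\<^sub>R v"] by (simp add: dist_norm add.assoc)
      also have "\<dots> \<le> h * norm u + h * norm v"
        using that by (intro add_mono mult_right_mono) auto
      also have "\<dots> < h * (norm u + norm v + 1)"
        using \<open>h > 0\<close> by (simp add: algebra_simps)
      also have "\<dots> = d" using pos by (simp add: h_def)
      finally show ?thesis .
    qed
    have near': "dist (x + s *\<^sub>R v + t *\<^sub>R u) x < d" if "0 \<le> s" "s \<le> h" "0 \<le> t" "t \<le> h" for s t
      using near[OF that(3,4,1,2)] by (simp add: algebra_simps)
    obtain s t where st: "0 < s" "s < h" "0 < t" "t < h" and
      1: "f (x + h *\<^sub>R u + h *\<^sub>R v) - f (x + h *\<^sub>R u) - f (x + h *\<^sub>R v) + f x =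
        h * h * D u v (x + s *\<^sub>R u + t *\<^sub>R v)"
      using second_difference_mvt[OF f \<open>h > 0\<close>, of x u v] near d unfolding D_def by metis
    obtain s' t' where st': "0 < s'" "s' < h" "0 < t'" "t' < h" and
      2: "f (x + h *\<^sub>R v + h *\<^sub>R u) - f (x + h *\<^sub>R v) - f (x + h *\<^sub>R u) + f x =
        h * h * D v u (x + s' *\<^sub>R v + t' *\<^sub>R u)"
      using second_difference_mvt[OF f \<open>h > 0\<close>, of x v u] near' d unfolding D_def by metis
    have "h * h * D u v (x + s *\<^sub>R u + t *\<^sub>R v) = h * h * D v u (x + s' *\<^sub>R v + t' *\<^sub>R u)"
      using 1 2 by (simp add: algebra_simps)
    then have "D u v (x + s *\<^sub>R u + t *\<^sub>R v) = D v u (x + s' *\<^sub>R v + t' *\<^sub>R u)"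
      using \<open>h > 0\<close> by simp
    moreover have "dist (D u v (x + s *\<^sub>R u + t *\<^sub>R v)) (D u v x) < e/2"
      using d near st by (meson less_imp_le)
    moreover have "dist (D v u (x + s' *\<^sub>R v + t' *\<^sub>R u)) (D v u x) < e/2"
      using d near' st' by (meson less_imp_le)
    ultimately show ?thesis unfolding dist_real_def by argo
  qed
  then have "D u v x = D v u x"
    by (metis abs_le_zero_iff dense_ge right_minus_eq)
  then show ?thesis by (simp add: D_def)
qed

section \<open>Partial derivatives of smooth functions on open sets\<close>

lemma partial_eq_frechet_derivative:
  fixes f :: "real^'n \<Rightarrow> real"
  assumes "f differentiable at x"
  shows "partial i f x = frechet_derivative f (at x) (axis i 1)"
  using has_real_derivative_along[of f x 0 "axis i 1"] assms
  by (simp add: partial_def has_real_derivative_iff_has_vector_derivative vector_derivative_at)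

lemma has_real_derivative_partial:
  fixes f :: "real^'n \<Rightarrow> real"
  assumes "f differentiable at x"
  shows "((\<lambda>t. f (x + t *\<^sub>R axis i 1)) has_real_derivative partial i f x) (at 0)"
  using has_real_derivative_along[of f x 0 "axis i 1"] assms
  by (simp add: partial_eq_frechet_derivative)

lemma eventually_line_in_open:
  fixes x u :: "'a::real_normed_vector"
  assumes "open S" "x \<in> S"
  shows "\<forall>\<^sub>F t in nhds 0. x + t *\<^sub>R u \<in> S"
proof -
  have "((\<lambda>t. x + t *\<^sub>R u) \<longlongrightarrow> x + 0 *\<^sub>R u) (nhds 0)"
    by (intro tendsto_intros filterlim_ident)
  then show ?thesis using assms topological_tendstoD by fastforce
qed

text \<open>A partial derivative sees only a short piece of a line through \<open>x\<close>, and
  that piece lies in \<open>S\<close>.\<close>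

lemma partial_cong_open:
  assumes "open S" "x \<in> S" "\<And>y. y \<in> S \<Longrightarrow> f y = g y"
  shows "partial i f x = partial i g x"
  unfolding partial_def
  by (rule vector_derivative_cong_eq)
    (use eventually_line_in_open[OF assms(1,2), of "axis i 1"] assms(3) in
      \<open>auto elim: eventually_mono\<close>)

lemma smooth_on_differentiable: "smooth_on f S \<Longrightarrow> x \<in> S \<Longrightarrow> f differentiable at x"
  using smooth_on_def times_cont_diff_on.simps(2) by blast

lemma smooth_on_partial:
  fixes f :: "real^'n \<Rightarrow> real"
  assumes "open S" "smooth_on f S"
  shows "smooth_on (partial i f) S"
  unfolding smooth_on_def
proof
  fix k
  have "times_cont_diff_on k (\<lambda>x. frechet_derivative f (at x) (axis i 1)) S"
    using assms(2) by (auto simp: smooth_on_def intro: times_cont_diff_on_frechet)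
  moreover have "partial i f x = frechet_derivative f (at x) (axis i 1)" if "x \<in> S" for x
    using smooth_on_differentiable[OF assms(2) that] by (rule partial_eq_frechet_derivative)
  ultimately show "times_cont_diff_on k (partial i f) S"
    using times_cont_diff_on_cong[OF assms(1),
        of "partial i f" "\<lambda>x. frechet_derivative f (at x) (axis i 1)" k] by blast
qed

lemma partial_commute:
  fixes f :: "real^'n \<Rightarrow> real"
  assumes "open S" "smooth_on f S" "x \<in> S"
  shows "partial i (partial j f) x = partial j (partial i f) x"
proof -
  have "partial i (partial j f) x =
      frechet_derivative (\<lambda>y. frechet_derivative f (at y) (axis j 1)) (at x) (axis i 1)" for i j
  proof -
    have "partial j f differentiable at x"
      using smooth_on_differentiable smooth_on_partial assms by blast
    moreover have "frechet_derivative (partial j f) (at x) =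
        frechet_derivative (\<lambda>y. frechet_derivative f (at y) (axis j 1)) (at x)"
      using calculation assms smooth_on_differentiable
      by (intro frechet_derivative_transform_within_open[of _ _ S]) (auto intro: partial_eq_frechet_derivative)
    ultimately show ?thesis by (simp add: partial_eq_frechet_derivative)
  qed
  moreover have "times_cont_diff_on 2 f S" using assms by (simp add: smooth_on_def)
  ultimately show ?thesis
    using frechet_derivative_second_symmetric assms(1,3) by metis
qed

section \<open>Inverses and entrywise derivatives of matrices\<close>

text \<open>\<open>matrix_inv\<close> is defined by choice; uniqueness of two-sided inverses
  identifies the chosen matrix.\<close>

lemma matrix_inv_eqI:
  fixes A B :: "'a::semiring_1^'n^'n"
  assumes "A ** B = mat 1" "B ** A = mat 1"
  shows "matrix_inv A = B"
proof -
  have "A ** matrix_inv A = mat 1 \<and> matrix_inv A ** A = mat 1"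
    unfolding matrix_inv_def using assms by (intro someI_ex[of "\<lambda>C. A ** C = mat 1 \<and> C ** A = mat 1"]) auto
  then show ?thesis
    by (metis assms(2) matrix_mul_assoc matrix_mul_lid matrix_mul_rid)
qed

lemma matrix_inv_2:
  fixes A :: "real^2^2"
  assumes "det A \<noteq> 0"
  shows "matrix_inv A $ 1 $ 1 = A $ 2 $ 2 / det A" "matrix_inv A $ 1 $ 2 = - A $ 1 $ 2 / det A"
    "matrix_inv A $ 2 $ 1 = - A $ 2 $ 1 / det A" "matrix_inv A $ 2 $ 2 = A $ 1 $ 1 / det A"
proof -
  define B :: "real^2^2" where
    "B = vector [vector [A $ 2 $ 2 / det A, - A $ 1 $ 2 / det A],
      vector [- A $ 2 $ 1 / det A, A $ 1 $ 1 / det A]]"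
  have "A ** B = mat 1" "B ** A = mat 1"
    using assms by (simp_all add: B_def vec_eq_iff forall_2 matrix_matrix_mult_def sum_2 mat_def
        field_simps) (simp_all add: det_2 field_simps)
  then have "matrix_inv A = B" by (rule matrix_inv_eqI)
  then show "matrix_inv A $ 1 $ 1 = A $ 2 $ 2 / det A" "matrix_inv A $ 1 $ 2 = - A $ 1 $ 2 / det A"
    "matrix_inv A $ 2 $ 1 = - A $ 2 $ 1 / det A" "matrix_inv A $ 2 $ 2 = A $ 1 $ 1 / det A"
    by (simp_all add: B_def)
qed

text \<open>Differentiation in a finite-dimensional space is componentwise, so partial derivatives
  of matrix functions reduce to scalar ones.\<close>

lemma partial_matrixI:
  fixes F :: "real^'n \<Rightarrow> real^'m^'k"
  assumes "\<And>i j. ((\<lambda>t. F (x + t *\<^sub>R axis \<alpha> 1) $ i $ j) has_real_derivative D i j) (at 0)"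
  shows "partial \<alpha> F x = (\<chi> i j. D i j)"
proof -
  have "((\<lambda>t. F (x + t *\<^sub>R axis \<alpha> 1)) has_vector_derivative (\<chi> i j. D i j)) (at 0)"
    using assms unfolding has_vector_derivative_def has_field_derivative_def
    by (subst has_derivative_componentwise_within)
      (auto simp: Basis_vec_def inner_axis mult_commute_abs)
  then show ?thesis by (simp add: partial_def vector_derivative_at)
qed

lemma smooth_on_const: "smooth_on (\<lambda>x. c) S"
  by (simp add: smooth_on_def times_cont_diff_on_const)

lemma smooth_on_add: "open S \<Longrightarrow> smooth_on f S \<Longrightarrow> smooth_on g S \<Longrightarrow> smooth_on (\<lambda>x. f x + g x) S"
  by (simp add: smooth_on_def times_cont_diff_on_add)

lemma smooth_on_mult:
  fixes f g :: "'a::real_normed_vector \<Rightarrow> real"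
  shows "open S \<Longrightarrow> smooth_on f S \<Longrightarrow> smooth_on g S \<Longrightarrow> smooth_on (\<lambda>x. f x * g x) S"
  by (simp add: smooth_on_def times_cont_diff_on_mult)

lemma smooth_on_powr:
  fixes f :: "'a::real_normed_vector \<Rightarrow> real"
  shows "open S \<Longrightarrow> smooth_on f S \<Longrightarrow> (\<And>x. x \<in> S \<Longrightarrow> f x > 0) \<Longrightarrow> smooth_on (\<lambda>x. f x powr r) S"
  by (simp add: smooth_on_def times_cont_diff_on_powr)

lemma smooth_has_partial:
  fixes f :: "real^'n \<Rightarrow> real"
  assumes "smooth_on f S" "x \<in> S"
  shows "((\<lambda>t. f (x + t *\<^sub>R axis i 1)) has_real_derivative partial i f x) (at 0)"
  using assms by (simp add: has_real_derivative_partial smooth_on_differentiable)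

lemma partialI:
  "((\<lambda>t. f (x + t *\<^sub>R axis i 1)) has_real_derivative D) (at 0) \<Longrightarrow> partial i f x = D"
  by (simp add: partial_def has_real_derivative_iff_has_vector_derivative vector_derivative_at)

section \<open>The divergence identity for Hessian-like matrices of constant determinant\<close>

text \<open>\<open>sym\<close> and \<open>hess\<close> together make the first derivatives of
  \<open>G\<close> totally symmetric. Differentiating the constant determinant once and twice then
  gives polynomial relations that force every entry of the divergence to vanish.\<close>

lemma divergence_current_zero:
  fixes G :: "real^2 \<Rightarrow> real^2^2"
  assumes U: "open U"
    and sm: "\<And>i j. smooth_on (\<lambda>y. G y $ i $ j) U"
    and sym: "\<And>y i j. y \<in> U \<Longrightarrow> G y $ i $ j = G y $ j $ i"
    and hess: "\<And>y i j k. y \<in> U \<Longrightarrow> partial k (\<lambda>z. G z $ i $ j) y = partial j (\<lambda>z. G z $ i $ k) y"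
    and det: "\<And>y. y \<in> U \<Longrightarrow> det (G y) = d" and "d \<noteq> 0" and x: "x \<in> U"
  shows "(\<Sum>\<alpha>\<in>UNIV. partial \<alpha> (\<lambda>y. \<Sum>\<beta>\<in>UNIV.
     (matrix_inv (G y) $ \<alpha> $ \<beta>) *\<^sub>R (matrix_inv (G y) ** partial \<beta> G y)) x) = 0"
proof -
  \<comment> \<open>\<open>P\<close> and \<open>Q\<close> hold the first and second derivatives of
    the entries of \<open>G\<close>; the indices after the first two are differentiations, and
    \<open>Q\<close> is taken at \<open>x\<close> only.\<close>
  define P where "P i j k = partial k (\<lambda>z. G z $ i $ j)" for i j k
  define Q where "Q i j k l = partial l (P i j k) x" for i j k l
  define K where "K \<alpha> y = (\<Sum>\<beta>\<in>UNIV.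
     (matrix_inv (G y) $ \<alpha> $ \<beta>) *\<^sub>R (matrix_inv (G y) ** partial \<beta> G y))" for \<alpha> y
  define r where "r = 1 / d"
  \<comment> \<open>\<open>M\<close> is the cofactor form of the inverse of \<open>G\<close>. As the
    determinant is the constant \<open>d\<close>, its entries are linear in those of
    \<open>G\<close>, and so is their derivative \<open>dM\<close> in the \<open>P\<close>.\<close>
  define M :: "2 \<Rightarrow> 2 \<Rightarrow> real^2 \<Rightarrow> real" where
    "M i j y = r * (if i = 1 then if j = 1 then G y $ 2 $ 2 else - G y $ 1 $ 2
      else if j = 1 then - G y $ 2 $ 1 else G y $ 1 $ 1)" for i j y
  define dM :: "2 \<Rightarrow> 2 \<Rightarrow> 2 \<Rightarrow> real" where
    "dM i j k = r * (if i = 1 then if j = 1 then P 2 2 k x else - P 1 2 k x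
      else if j = 1 then - P 2 1 k x else P 1 1 k x)" for i j k
  have smP: "smooth_on (P i j k) U" for i j k
    unfolding P_def using sm U by (rule smooth_on_partial[rotated])
  have DG: "((\<lambda>t. G (y + t *\<^sub>R axis k 1) $ i $ j) has_real_derivative P i j k y) (at 0)"
    if "y \<in> U" for i j k y
    unfolding P_def using sm that by (rule smooth_has_partial)
  have DP: "((\<lambda>t. P i j k (x + t *\<^sub>R axis l 1)) has_real_derivative Q i j k l) (at 0)" for i j k l
    unfolding Q_def using smP x by (rule smooth_has_partial)
  have DM: "((\<lambda>t. M i j (x + t *\<^sub>R axis k 1)) has_real_derivative dM i j k) (at 0)" for i j k
    using DG[OF x] \<open>d \<noteq> 0\<close> unfolding M_def dM_def
    by (cases "i = 1"; cases "j = 1") (auto intro!: DERIV_cmult DERIV_minus)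
  have inv: "matrix_inv (G y) $ i $ j = M i j y" if "y \<in> U" for y i j
    using matrix_inv_2[of "G y"] det[OF that] \<open>d \<noteq> 0\<close> exhaust_2[of i] exhaust_2[of j]
    by (auto simp: M_def r_def)
  have PG: "partial k G y $ i $ j = P i j k y" if "y \<in> U" for y i j k
    using partial_matrixI[OF DG[OF that], of k] by simp
  have K: "K \<alpha> y $ i $ j = (\<Sum>\<beta>\<in>UNIV. M \<alpha> \<beta> y * (\<Sum>\<sigma>\<in>UNIV. M i \<sigma> y * P \<sigma> j \<beta> y))"
    if "y \<in> U" for \<alpha> y i j
    by (simp add: K_def matrix_matrix_mult_def inv PG that)
  have "partial \<alpha> (K \<alpha>) x = (\<chi> i j. \<Sum>\<beta>\<in>UNIV.
      M \<alpha> \<beta> x * (\<Sum>\<sigma>\<in>UNIV. dM i \<sigma> \<alpha> * P \<sigma> j \<beta> x + M i \<sigma> x * Q \<sigma> j \<beta> \<alpha>)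
      + dM \<alpha> \<beta> \<alpha> * (\<Sum>\<sigma>\<in>UNIV. M i \<sigma> x * P \<sigma> j \<beta> x))" for \<alpha>
  proof (rule partial_matrixI)
    fix i j
    have "((\<lambda>t. \<Sum>\<beta>\<in>UNIV. M \<alpha> \<beta> (x + t *\<^sub>R axis \<alpha> 1) * (\<Sum>\<sigma>\<in>UNIV.
          M i \<sigma> (x + t *\<^sub>R axis \<alpha> 1) * P \<sigma> j \<beta> (x + t *\<^sub>R axis \<alpha> 1)))
      has_real_derivative (\<Sum>\<beta>\<in>UNIV.
      M \<alpha> \<beta> x * (\<Sum>\<sigma>\<in>UNIV. dM i \<sigma> \<alpha> * P \<sigma> j \<beta> x + M i \<sigma> x * Q \<sigma> j \<beta> \<alpha>)
      + dM \<alpha> \<beta> \<alpha> * (\<Sum>\<sigma>\<in>UNIV. M i \<sigma> x * P \<sigma> j \<beta> x))) (at 0)"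
      by (auto intro!: derivative_eq_intros DM DP sum.cong simp: algebra_simps)
    \<comment> \<open>The formula for \<open>K\<close> holds only on \<open>U\<close>, which
      suffices for a derivative at \<open>t = 0\<close>.\<close>
    moreover have "\<forall>\<^sub>F t in nhds 0. K \<alpha> (x + t *\<^sub>R axis \<alpha> 1) $ i $ j =
       (\<Sum>\<beta>\<in>UNIV. M \<alpha> \<beta> (x + t *\<^sub>R axis \<alpha> 1) * (\<Sum>\<sigma>\<in>UNIV.
          M i \<sigma> (x + t *\<^sub>R axis \<alpha> 1) * P \<sigma> j \<beta> (x + t *\<^sub>R axis \<alpha> 1)))"
      using eventually_line_in_open[OF U x] by (rule eventually_mono) (rule K)
    ultimately show "((\<lambda>t. K \<alpha> (x + t *\<^sub>R axis \<alpha> 1) $ i $ j) has_real_derivative (\<Sum>\<beta>\<in>UNIV.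
      M \<alpha> \<beta> x * (\<Sum>\<sigma>\<in>UNIV. dM i \<sigma> \<alpha> * P \<sigma> j \<beta> x + M i \<sigma> x * Q \<sigma> j \<beta> \<alpha>)
      + dM \<alpha> \<beta> \<alpha> * (\<Sum>\<sigma>\<in>UNIV. M i \<sigma> x * P \<sigma> j \<beta> x))) (at 0)"
      by (subst DERIV_cong_ev[OF refl _ refl]) auto
  qed
  note partial_K = this
  have P1: "P i j k y = P i k j y" and P2: "P i j k y = P j i k y" if "y \<in> U" for i j k y
    unfolding P_def by (rule hess[OF that], rule partial_cong_open[OF U that sym])
  have Q1: "Q i j k l = Q i k j l" and Q2: "Q i j k l = Q j i k l" for i j k l
    unfolding Q_def by (auto intro!: partial_cong_open[OF U x] P1 P2)
  have Q3: "Q i j k l = Q i j l k" for i j k l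
    unfolding Q_def P_def using partial_commute[OF U sm x] .
  \<comment> \<open>This is the derivative of the constant determinant. It is proved at every
    \<open>y\<close> in \<open>U\<close>, so that it can be differentiated again in
    \<open>E2\<close>.\<close>
  have E: "P 1 1 k y * G y $ 2 $ 2 + G y $ 1 $ 1 * P 2 2 k y - 2 * G y $ 1 $ 2 * P 1 2 k y = 0"
    if "y \<in> U" for y k
  proof -
    have "((\<lambda>t. det (G (y + t *\<^sub>R axis k 1))) has_real_derivative
        P 1 1 k y * G y $ 2 $ 2 + G y $ 1 $ 1 * P 2 2 k y
         - (P 1 2 k y * G y $ 2 $ 1 + G y $ 1 $ 2 * P 2 1 k y)) (at 0)"
      unfolding det_2 by (auto intro!: derivative_eq_intros DG that)
    moreover have "\<forall>\<^sub>F t in nhds 0. det (G (y + t *\<^sub>R axis k 1)) = d"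
      using eventually_line_in_open[OF U that] by (rule eventually_mono) (rule det)
    ultimately have "((\<lambda>t. d) has_real_derivative
        P 1 1 k y * G y $ 2 $ 2 + G y $ 1 $ 1 * P 2 2 k y
         - (P 1 2 k y * G y $ 2 $ 1 + G y $ 1 $ 2 * P 2 1 k y)) (at 0)"
      by (subst (asm) DERIV_cong_ev[OF refl _ refl]) auto
    then show ?thesis
      using DERIV_unique[OF _ DERIV_const] sym[OF that, of 2 1] P2[OF that, of 2 1]
      by (fastforce simp: algebra_simps)
  qed
  have E2: "Q 1 1 k l * G x $ 2 $ 2 + P 1 1 k x * P 2 2 l x
      + P 1 1 l x * P 2 2 k x + G x $ 1 $ 1 * Q 2 2 k l
      - 2 * (P 1 2 l x * P 1 2 k x + G x $ 1 $ 2 * Q 1 2 k l) = 0" for k l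
  proof -
    let ?f = "\<lambda>y. P 1 1 k y * G y $ 2 $ 2 + G y $ 1 $ 1 * P 2 2 k y - 2 * (G y $ 1 $ 2 * P 1 2 k y)"
    have "partial l ?f x = Q 1 1 k l * G x $ 2 $ 2 + P 1 1 k x * P 2 2 l x
      + P 1 1 l x * P 2 2 k x + G x $ 1 $ 1 * Q 2 2 k l
      - 2 * (P 1 2 l x * P 1 2 k x + G x $ 1 $ 2 * Q 1 2 k l)"
      by (rule partialI) (auto intro!: derivative_eq_intros DG[OF x] DP simp: algebra_simps)
    moreover have "partial l ?f x = partial l (\<lambda>y. 0) x"
      using E by (intro partial_cong_open[OF U x]) (simp add: mult_ac)
    moreover have "partial l (\<lambda>y. 0::real) x = 0" by (simp add: partial_def)
    ultimately show ?thesis by simp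
  qed
  \<comment> \<open>These instances act as rewrite rules that sort the indices, leaving four first
    derivatives and five second derivatives as unknowns.\<close>
  note symP = P1[OF x, of 1 2 1] P1[OF x, of 2 2 1] P2[OF x, of 2 1] 
  note symQ = Q1[of 1 2 1] Q1[of 2 2 1] Q2[of 2 1] Q3[of _ _ 2 1]
  have eqs: "P 1 1 1 x * G x $ 2 $ 2 + G x $ 1 $ 1 * P 1 2 2 x - 2 * G x $ 1 $ 2 * P 1 1 2 x = 0"
    "P 1 1 2 x * G x $ 2 $ 2 + G x $ 1 $ 1 * P 2 2 2 x - 2 * G x $ 1 $ 2 * P 1 2 2 x = 0"
    "Q 1 1 1 1 * G x $ 2 $ 2 + 2 * (P 1 1 1 x * P 1 2 2 x) + G x $ 1 $ 1 * Q 1 1 2 2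
      - 2 * (P 1 1 2 x * P 1 1 2 x + G x $ 1 $ 2 * Q 1 1 1 2) = 0"
    "Q 1 1 1 2 * G x $ 2 $ 2 + P 1 1 1 x * P 2 2 2 x + P 1 1 2 x * P 1 2 2 x
      + G x $ 1 $ 1 * Q 1 2 2 2 - 2 * (P 1 2 2 x * P 1 1 2 x + G x $ 1 $ 2 * Q 1 1 2 2) = 0"
    "Q 1 1 2 2 * G x $ 2 $ 2 + 2 * (P 1 1 2 x * P 2 2 2 x) + G x $ 1 $ 1 * Q 2 2 2 2
      - 2 * (P 1 2 2 x * P 1 2 2 x + G x $ 1 $ 2 * Q 1 2 2 2) = 0"
    using E[OF x, of 1] E[OF x, of 2] E2[of 1 1] E2[of 1 2] E2[of 2 2]
    by (simp_all add: symP symQ)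
  have "(\<Sum>\<alpha>\<in>UNIV. partial \<alpha> (K \<alpha>) x) = 0"
    \<comment> \<open>Each of the four entries is now a polynomial that vanishes as a consequence of
      \<open>eqs\<close>.\<close>
    by (simp add: partial_K vec_eq_iff forall_2 sum_2 M_def dM_def symP symQ sym[OF x, of 2 1];
        intro conjI; use eqs in algebra)
  then show ?thesis unfolding K_def .
qed

section \<open>The metric of a graph and the minimality equation\<close>

lemma transpose_eq_entries:
  assumes "transpose A = A"
  shows "A $ i $ j = A $ j $ i"
proof -
  have "transpose A $ i $ j = A $ j $ i" by (simp add: transpose_def)
  then show ?thesis unfolding assms .
qed

lemma graph_rho_eq:
  assumes "transpose g0 = g0" "det g0 \<noteq> 0"
  shows "graph_rho e g0 \<phi> x = 1 + e * (g0 $ 2 $ 2 * partial 1 \<phi> x * partial 1 \<phi> x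
    - 2 * g0 $ 1 $ 2 * partial 1 \<phi> x * partial 2 \<phi> x
    + g0 $ 1 $ 1 * partial 2 \<phi> x * partial 2 \<phi> x) / det g0"
proof -
  have "g0 $ 2 $ 1 = g0 $ 1 $ 2"
    using assms(1) by (rule transpose_eq_entries)
  then show ?thesis
    using assms(2) by (simp add: graph_rho_def sum_2 matrix_inv_2 field_simps)
qed

text \<open>This is the determinant formula for a rank-one update of \<open>g0\<close>, checked by
  expansion in dimension two.\<close>

lemma det_induced_metric:
  assumes "transpose g0 = g0" "det g0 \<noteq> 0"
  shows "det (induced_metric e g0 \<phi> x) = graph_rho e g0 \<phi> x * det g0"
proof -
  have "g0 $ 2 $ 1 = g0 $ 1 $ 2"
    using assms(1) by (rule transpose_eq_entries)
  moreover have "graph_rho e g0 \<phi> x * det g0 = det g0 + e * (g0 $ 2 $ 2 * partial 1 \<phi> x * partial 1 \<phi> x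
    - 2 * g0 $ 1 $ 2 * partial 1 \<phi> x * partial 2 \<phi> x
    + g0 $ 1 $ 1 * partial 2 \<phi> x * partial 2 \<phi> x)"
    using assms(2) by (simp add: graph_rho_eq[OF assms] field_simps)
  ultimately show ?thesis
    by (simp add: induced_metric_def det_2 algebra_simps)
qed

text \<open>In dimension two the determinant scales by the square of the factor, here 1/\<rho>,
  which cancels the \<rho> in the determinant of the induced metric.\<close>

lemma det_rescaled_metric:
  assumes "transpose g0 = g0" "det g0 \<noteq> 0" "graph_rho e g0 \<phi> x > 0"
  shows "det (rescaled_metric e g0 \<phi> x) = det g0"
proof -
  let ?\<rho> = "graph_rho e g0 \<phi> x"
  have "det (rescaled_metric e g0 \<phi> x) =
      (?\<rho> powr (-1/2) * ?\<rho> powr (-1/2)) * det (induced_metric e g0 \<phi> x)"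
    by (simp add: rescaled_metric_def det_2 algebra_simps)
  also have "?\<rho> powr (-1/2) * ?\<rho> powr (-1/2) = inverse ?\<rho>"
    using assms(3) by (subst powr_add[symmetric]) (simp add: powr_minus)
  finally show ?thesis
    using assms(3) by (simp add: det_induced_metric[OF assms(1,2)])
qed

text \<open>Cancelling the positive power of \<rho> and multiplying by the determinant of the
  induced metric turns vanishing mean curvature into a polynomial relation.\<close>

lemma minimal_graph_equation:
  assumes "transpose g0 = g0" "det g0 \<noteq> 0" "graph_rho e g0 \<phi> x > 0"
    and "graph_mean_curvature e g0 \<phi> x = 0"
    and comm: "partial 1 (partial 2 \<phi>) x = partial 2 (partial 1 \<phi>) x"
  shows "induced_metric e g0 \<phi> x $ 2 $ 2 * partial 1 (partial 1 \<phi>) x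
    - 2 * induced_metric e g0 \<phi> x $ 1 $ 2 * partial 2 (partial 1 \<phi>) x
    + induced_metric e g0 \<phi> x $ 1 $ 1 * partial 2 (partial 2 \<phi>) x = 0"
proof -
  let ?h = "induced_metric e g0 \<phi> x"
  have "det ?h \<noteq> 0" using assms(2,3) by (simp add: det_induced_metric[OF assms(1,2)])
  moreover have "?h $ 2 $ 1 = ?h $ 1 $ 2"
    using transpose_eq_entries[OF assms(1), of 2 1] by (simp add: induced_metric_def)
  moreover have "(\<Sum>\<mu>\<in>UNIV. \<Sum>\<nu>\<in>UNIV. matrix_inv ?h $ \<mu> $ \<nu> * partial \<mu> (partial \<nu> \<phi>) x) = 0"
    using assms(3,4) by (simp add: graph_mean_curvature_def)
  ultimately show ?thesis
    by (simp add: sum_2 matrix_inv_2 comm) (simp add: field_simps)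
qed

text \<open>The common factor \<rho>^(-1/2)/\<rho> is split off so that the other factor contains no
  fractional powers and can be treated by polynomial algebra.\<close>

lemma partial_rescaled_metric:
  fixes g0 :: "real^2^2"
  assumes "transpose g0 = g0" "det g0 \<noteq> 0" "open U" "smooth_on \<phi> U" "x \<in> U"
    and pos: "graph_rho e g0 \<phi> x > 0"
  shows "partial k (\<lambda>y. rescaled_metric e g0 \<phi> y $ i $ j) x =
    graph_rho e g0 \<phi> x powr (-1/2) / graph_rho e g0 \<phi> x *
    (graph_rho e g0 \<phi> x * e * (partial k (partial i \<phi>) x * partial j \<phi> x + partial i \<phi> x * partial k (partial j \<phi>) x)
    - e * ((g0 $ 2 $ 2 * partial 1 \<phi> x - g0 $ 1 $ 2 * partial 2 \<phi> x) * partial k (partial 1 \<phi>) x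
         + (g0 $ 1 $ 1 * partial 2 \<phi> x - g0 $ 1 $ 2 * partial 1 \<phi> x) * partial k (partial 2 \<phi>) x) / det g0
      * induced_metric e g0 \<phi> x $ i $ j)"
proof (rule partialI)
  have D: "((\<lambda>t. partial i \<phi> (x + t *\<^sub>R axis k 1)) has_real_derivative partial k (partial i \<phi>) x) (at 0)" for i
    using smooth_on_partial[OF assms(3,4)] assms(5) by (rule smooth_has_partial)
  let ?\<rho> = "graph_rho e g0 \<phi> x"
  \<comment> \<open>\<open>Y\<close> is half the derivative of \<rho> in direction \<open>k\<close>,
    which absorbs the exponent -1/2 in the chain rule; \<open>Z\<close> is the derivative of the
    entry of the induced metric.\<close>
  define Y where "Y = e * ((g0 $ 2 $ 2 * partial 1 \<phi> x - g0 $ 1 $ 2 * partial 2 \<phi> x) * partial k (partial 1 \<phi>) x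
         + (g0 $ 1 $ 1 * partial 2 \<phi> x - g0 $ 1 $ 2 * partial 1 \<phi> x) * partial k (partial 2 \<phi>) x) / det g0"
  define Z where "Z = e * (partial k (partial i \<phi>) x * partial j \<phi> x + partial i \<phi> x * partial k (partial j \<phi>) x)"
  have "((\<lambda>t. graph_rho e g0 \<phi> (x + t *\<^sub>R axis k 1)) has_real_derivative 2 * Y) (at 0)"
    unfolding graph_rho_eq[OF assms(1,2)] Y_def
    using assms(2) by (auto intro!: derivative_eq_intros D simp: field_simps)
  from DERIV_fun_powr[OF this, of "-1/2"] pos
  have "((\<lambda>t. graph_rho e g0 \<phi> (x + t *\<^sub>R axis k 1) powr (-1/2)) has_real_derivative
     (-1/2) * ?\<rho> powr (-1/2 - 1) * (2 * Y)) (at 0)"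
    by simp
  moreover have "((\<lambda>t. induced_metric e g0 \<phi> (x + t *\<^sub>R axis k 1) $ i $ j) has_real_derivative Z) (at 0)"
    unfolding induced_metric_def Z_def
    by (auto intro!: derivative_eq_intros D simp: algebra_simps)
  ultimately have "((\<lambda>t. rescaled_metric e g0 \<phi> (x + t *\<^sub>R axis k 1) $ i $ j) has_real_derivative
    (-1/2) * ?\<rho> powr (-1/2 - 1) * (2 * Y) * induced_metric e g0 \<phi> x $ i $ j + Z * ?\<rho> powr (-1/2)) (at 0)"
    using DERIV_mult by (fastforce simp: rescaled_metric_def)
  moreover have "(-1/2) * ?\<rho> powr (-1/2 - 1) * (2 * Y) * induced_metric e g0 \<phi> x $ i $ j + Z * ?\<rho> powr (-1/2) =
    ?\<rho> powr (-1/2) / ?\<rho> * (?\<rho> * Z - Y * induced_metric e g0 \<phi> x $ i $ j)"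
  proof -
    have "?\<rho> powr (-1/2 - 1) = ?\<rho> powr (-1/2) / ?\<rho>"
      using pos by (subst powr_diff) simp
    then show ?thesis using pos by (simp only:) (simp add: field_simps)
  qed
  ultimately have "((\<lambda>t. rescaled_metric e g0 \<phi> (x + t *\<^sub>R axis k 1) $ i $ j) has_real_derivative
    ?\<rho> powr (-1/2) / ?\<rho> * (?\<rho> * Z - Y * induced_metric e g0 \<phi> x $ i $ j)) (at 0)"
    by (simp only:)
  then show "((\<lambda>t. rescaled_metric e g0 \<phi> (x + t *\<^sub>R axis k 1) $ i $ j) has_real_derivative
    ?\<rho> powr (-1/2) / ?\<rho> *
    (?\<rho> * e * (partial k (partial i \<phi>) x * partial j \<phi> x + partial i \<phi> x * partial k (partial j \<phi>) x)
    - e * ((g0 $ 2 $ 2 * partial 1 \<phi> x - g0 $ 1 $ 2 * partial 2 \<phi> x) * partial k (partial 1 \<phi>) x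
         + (g0 $ 1 $ 1 * partial 2 \<phi> x - g0 $ 1 $ 2 * partial 1 \<phi> x) * partial k (partial 2 \<phi>) x) / det g0
      * induced_metric e g0 \<phi> x $ i $ j)) (at 0)"
    unfolding Y_def Z_def by (simp only: mult.assoc)
qed

text \<open>This is where minimality enters: it supplies the hypothesis \<open>hess\<close> of
  \<open>divergence_current_zero\<close>.\<close>

lemma partial_rescaled_metric_symmetric:
  fixes g0 :: "real^2^2"
  assumes "transpose g0 = g0" "det g0 \<noteq> 0" "open U" "smooth_on \<phi> U" "x \<in> U"
    and "graph_rho e g0 \<phi> x > 0" "graph_mean_curvature e g0 \<phi> x = 0"
  shows "partial k (\<lambda>y. rescaled_metric e g0 \<phi> y $ i $ j) x =
    partial j (\<lambda>y. rescaled_metric e g0 \<phi> y $ i $ k) x"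
proof -
  have comm: "partial 1 (partial 2 \<phi>) x = partial 2 (partial 1 \<phi>) x"
    using assms(3-5) by (rule partial_commute)
  have g21: "g0 $ 2 $ 1 = g0 $ 1 $ 2"
    using assms(1) by (rule transpose_eq_entries)
  \<comment> \<open>Naming the reciprocal and recording its defining relation replaces division by
    polynomial algebra.\<close>
  define r where "r = 1 / det g0"
  have r: "r * (g0 $ 1 $ 1 * g0 $ 2 $ 2 - g0 $ 1 $ 2 * g0 $ 1 $ 2) = 1"
    using assms(2) by (simp add: r_def det_2 g21)
  have div: "y / det g0 = r * y" for y by (simp add: r_def)
  note eqs = minimal_graph_equation[OF assms(1,2,6,7) comm, simplified induced_metric_def, simplified]
    r graph_rho_eq[OF assms(1,2), of e \<phi> x, unfolded div]
  have "partial 2 (\<lambda>y. rescaled_metric e g0 \<phi> y $ i $ 1) x =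
      partial 1 (\<lambda>y. rescaled_metric e g0 \<phi> y $ i $ 2) x"
  proof -
    consider "i = 1" | "i = 2" using exhaust_2 by blast
    then show ?thesis
    proof cases
      case 1
      show ?thesis
        unfolding partial_rescaled_metric[OF assms(1-6)] div 1 comm
        \<comment> \<open>Both sides share the factor \<rho>^(-1/2)/\<rho>. Once it is stripped, the
          claim follows from the minimality equation, the relation for \<open>r\<close> and the
          formula for \<rho>.\<close>
        by (rule arg_cong[where f = "\<lambda>z. _ * z"])
          (simp add: induced_metric_def g21, use eqs in algebra)
    next
      case 2
      show ?thesis
        unfolding partial_rescaled_metric[OF assms(1-6)] div 2 comm
        by (rule arg_cong[where f = "\<lambda>z. _ * z"])
          (simp add: induced_metric_def g21, use eqs in algebra)
    qed
  qed
  then show ?thesis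
    using exhaust_2[of j] exhaust_2[of k] by auto
qed

section \<open>Smoothness of the rescaled metric and conclusion\<close>

theorem proposition5:
  fixes e :: real and g0 :: "real^2^2" and \<phi> :: "real^2 \<Rightarrow> real" and U :: "(real^2) set"
    and g :: "real^2 \<Rightarrow> real^2^2"
  assumes "e \<in> {1, -1}"
    and "transpose g0 = g0"
    and "invertible g0"
    and "open U"
    and "smooth_on \<phi> U"
    and "\<forall>x\<in>U. graph_rho e g0 \<phi> x > 0"
    and "\<forall>x\<in>U. graph_mean_curvature e g0 \<phi> x = 0"
  defines "g \<equiv> rescaled_metric e g0 \<phi>"
  shows "\<forall>x\<in>U. (\<Sum>\<alpha>\<in>UNIV. partial \<alpha>
           (\<lambda>y. \<Sum>\<beta>\<in>UNIV. (matrix_inv (g y) $ \<alpha> $ \<beta>) *\<^sub>R (matrix_inv (g y) ** partial \<beta> g y)) x) = 0"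
proof
  fix x assume "x \<in> U"
  have det: "det g0 \<noteq> 0" using assms(3) by (simp add: invertible_det_nz)
  have p: "smooth_on (partial i \<phi>) U" for i
    using assms(4,5) by (rule smooth_on_partial)
  \<comment> \<open>\<rho> is written out as a polynomial in the first derivatives of \<phi>, so the
    closure rules apply; its positivity on \<open>U\<close> then handles the power -1/2.\<close>
  have "smooth_on (\<lambda>y. 1 + e * (\<Sum>\<mu>\<in>UNIV. \<Sum>\<nu>\<in>UNIV.
      matrix_inv g0 $ \<mu> $ \<nu> * partial \<mu> \<phi> y * partial \<nu> \<phi> y)) U"
    unfolding sum_2
    by (intro smooth_on_add smooth_on_mult smooth_on_const p assms(4))
  then have "smooth_on (\<lambda>y. graph_rho e g0 \<phi> y powr (-1/2)) U"
    using assms(4,6) by (intro smooth_on_powr) (simp_all add: graph_rho_def[abs_def])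
  then have "smooth_on (\<lambda>y. graph_rho e g0 \<phi> y powr (-1/2) * (g0 $ i $ j + e * partial i \<phi> y * partial j \<phi> y)) U" for i j
    by (intro smooth_on_add smooth_on_mult smooth_on_const p assms(4))
  then have smooth: "smooth_on (\<lambda>y. g y $ i $ j) U" for i j
    by (simp add: g_def rescaled_metric_def induced_metric_def)
  have "g0 $ i $ j = g0 $ j $ i" for i j
    using assms(2) by (rule transpose_eq_entries)
  then have sym: "g y $ i $ j = g y $ j $ i" for y i j
    by (simp add: g_def rescaled_metric_def induced_metric_def mult_ac)
  show "(\<Sum>\<alpha>\<in>UNIV. partial \<alpha>
           (\<lambda>y. \<Sum>\<beta>\<in>UNIV. (matrix_inv (g y) $ \<alpha> $ \<beta>) *\<^sub>R (matrix_inv (g y) ** partial \<beta> g y)) x) = 0"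
  proof (rule divergence_current_zero[OF assms(4) smooth sym _ _ det \<open>x \<in> U\<close>])
    show "partial k (\<lambda>z. g z $ i $ j) y = partial j (\<lambda>z. g z $ i $ k) y" if "y \<in> U" for y i j k
      unfolding g_def using partial_rescaled_metric_symmetric[OF assms(2) det assms(4,5) that] assms(6,7) that
      by blast
    show "det (g y) = det g0" if "y \<in> U" for y
      unfolding g_def using assms(6) that by (intro det_rescaled_metric assms(2) det) blast
  qed
qed

end
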